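(* Suppose there exists $\gamma>0$ such that every true pair has zero compatibility cost, $d_\Omega(\rho_{k,1},\rho_{k,2})=0$ for $k=1,\dots,r$, while every false pair satisfies $d_\Omega(\rho_{k,1},\rho_{\ell,2})\ge\gamma$ for all $k\ne\ell$. Then the true pairing is the unique minimum-total-cost bipartite matching; that is, the identity is the unique minimizer of $\sum_{k=1}^r d_\Omega(\rho_{k,1},\rho_{\pi(k),2})$ over permutations $\pi$ of $\{1,\dots,r\}$. Suppose, more generally, that nonnegative perturbed costs $\widetilde d_{k\ell}$, $1\le k,\ell\le r$, satisfy $$|\widetilde d_{k\ell}-d_\Omega(\rho_{k,1},\rho_{\ell,2})|\le\delta\qquad\text{for all }k,\ell.$$ If $$\delta<\frac{\gamma}{r+1},$$ then the true pairing remains the unique minimum-total-cost matching, i.e. the identity is the unique minimizer of $\sum_{k=1}^r\widetilde d_{k\pi(k)}$ over permutations $\pi$ of $\{1,\dots,r\}$.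
   Context: Let $q_1,q_2\in(0,1)$, $h_j=\log q_j$, $r\ge1$, $\alpha_1,\dots,\alpha_r\in\mathbb C$, and $\rho_{\ell,j}=q_j^{\alpha_\ell}=e^{h_j\alpha_\ell}$ for $j=1,2$. Let $\Omega\subset\mathbb C$ be an admissible set of exponents. The compatibility cost of $z_1,z_2\in\mathbb C$ is $$d_\Omega(z_1,z_2)=\inf_{\alpha\in\Omega}\left(|e^{h_1\alpha}-z_1|^2+|e^{h_2\alpha}-z_2|^2\right)^{1/2}.$$ A matching between the nodes at scale $q_1$ and those at scale $q_2$ is a permutation $\pi$ (pairing $\rho_{k,1}$ with $\rho_{\pi(k),2}$), its total cost is the sum of the costs of its pairs, and the true pairing is the identity. *)

theory Defs
  imports Complex_Main "HOL-Combinatorics.Permutations"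
begin

definition node :: "real \<Rightarrow> complex \<Rightarrow> complex" where
  "node q \<alpha> = exp (complex_of_real (ln q) * \<alpha>)"

(* The infimum is taken in the reals: the set is bounded below by 0, so it is the usual
   infimum whenever \<Omega> is nonempty.  For empty \<Omega> it is an unspecified constant, independent
   of z1 and z2. *)
definition compat_cost :: "real \<Rightarrow> real \<Rightarrow> complex set \<Rightarrow> complex \<Rightarrow> complex \<Rightarrow> real" where
  "compat_cost q1 q2 \<Omega> z1 z2 =
     (INF \<alpha>\<in>\<Omega>. sqrt ((cmod (exp (complex_of_real (ln q1) * \<alpha>) - z1))\<^sup>2
                    + (cmod (exp (complex_of_real (ln q2) * \<alpha>) - z2))\<^sup>2))"

definition total_cost :: "nat \<Rightarrow> (nat \<Rightarrow> nat \<Rightarrow> real) \<Rightarrow> (nat \<Rightarrow> nat) \<Rightarrow> real" where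
  "total_cost r c \<pi> = (\<Sum>k=1..r. c k (\<pi> k))"

definition min_cost_matching :: "nat \<Rightarrow> (nat \<Rightarrow> nat \<Rightarrow> real) \<Rightarrow> (nat \<Rightarrow> nat) \<Rightarrow> bool" where
  "min_cost_matching r c = is_arg_min (total_cost r c) (\<lambda>\<pi>. \<pi> permutes {1..r})"

definition unique_min_cost_matching :: "nat \<Rightarrow> (nat \<Rightarrow> nat \<Rightarrow> real) \<Rightarrow> (nat \<Rightarrow> nat) \<Rightarrow> bool" where
  "unique_min_cost_matching r c \<pi> \<longleftrightarrow> (\<forall>\<sigma>. min_cost_matching r c \<sigma> \<longleftrightarrow> \<sigma> = \<pi>)"

end

theory Submission
  imports Defs
begin

text \<open>
  The hypotheses make every diagonal cost strictly smaller than every other cost in its row. For the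
  exact costs this is \<open>0 < \<gamma>\<close>. After perturbation a diagonal entry is at most \<open>\<delta>\<close> and any other entry
  is at least \<open>\<gamma> - \<delta>\<close>, and \<open>\<delta> < \<gamma> / (r + 1) \<le> \<gamma> / 2\<close> puts the first below the second.

  A cost matrix of this kind has the identity as its unique optimal matching, because any other
  permutation can be compared with the identity row by row: it does at least as badly in every row
  and strictly worse in each row that it moves. In this comparison the perturbation errors on
  fixed rows cancel, and those on moved rows do not accumulate.
\<close>

lemma unique_min_cost_matching_id_if_diagonal_dominates:
  fixes c :: "nat \<Rightarrow> nat \<Rightarrow> real"
  assumes diag: "\<And>k l. k \<in> {1..r} \<Longrightarrow> l \<in> {1..r} \<Longrightarrow> k \<noteq> l \<Longrightarrow> c k k < c k l"
  shows "unique_min_cost_matching r c id"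
proof -
  have better: "total_cost r c id < total_cost r c \<sigma>"
    if perm: "\<sigma> permutes {1..r}" and "\<sigma> \<noteq> id" for \<sigma>
    unfolding total_cost_def
  proof (rule sum_strict_mono_ex1)
    have row: "\<sigma> k \<in> {1..r}" if "k \<in> {1..r}" for k
      using permutes_in_image[OF perm] that by blast
    show "\<forall>k\<in>{1..r}. c k (id k) \<le> c k (\<sigma> k)"
    proof
      fix k assume "k \<in> {1..r}"
      then show "c k (id k) \<le> c k (\<sigma> k)"
        using diag[of k "\<sigma> k"] row by (cases "\<sigma> k = k") auto
    qed
    obtain k where "\<sigma> k \<noteq> k"
      using \<open>\<sigma> \<noteq> id\<close> by (auto simp: fun_eq_iff)
    moreover from this have "k \<in> {1..r}"
      using permutes_not_in[OF perm] by blast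
    ultimately have "c k (id k) < c k (\<sigma> k)"
      using diag[of k "\<sigma> k"] row by simp
    with \<open>k \<in> {1..r}\<close> show "\<exists>k\<in>{1..r}. c k (id k) < c k (\<sigma> k)" ..
  qed simp
  have id_perm: "id permutes {1..r}"
    by (rule permutes_id)
  show ?thesis
    unfolding unique_min_cost_matching_def min_cost_matching_def is_arg_min_def
    using better id_perm by (metis less_irrefl less_asym)
qed

theorem proposition3p4:
  fixes q1 q2 \<gamma> :: real and r :: nat and \<alpha> :: "nat \<Rightarrow> complex" and \<Omega> :: "complex set"
  assumes "0 < q1" "q1 < 1" "0 < q2" "q2 < 1"
    and "r \<ge> 1"
    and "\<gamma> > 0"
    and "\<And>k. k \<in> {1..r} \<Longrightarrow> compat_cost q1 q2 \<Omega> (node q1 (\<alpha> k)) (node q2 (\<alpha> k)) = 0"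
    and "\<And>k l. k \<in> {1..r} \<Longrightarrow> l \<in> {1..r} \<Longrightarrow> k \<noteq> l \<Longrightarrow>
           compat_cost q1 q2 \<Omega> (node q1 (\<alpha> k)) (node q2 (\<alpha> l)) \<ge> \<gamma>"
  shows "unique_min_cost_matching r
           (\<lambda>k l. compat_cost q1 q2 \<Omega> (node q1 (\<alpha> k)) (node q2 (\<alpha> l))) id
       \<and> (\<forall>(d :: nat \<Rightarrow> nat \<Rightarrow> real) (\<delta> :: real).
            (\<forall>k\<in>{1..r}. \<forall>l\<in>{1..r}. d k l \<ge> 0) \<longrightarrow>
            (\<forall>k\<in>{1..r}. \<forall>l\<in>{1..r}.
               \<bar>d k l - compat_cost q1 q2 \<Omega> (node q1 (\<alpha> k)) (node q2 (\<alpha> l))\<bar> \<le> \<delta>) \<longrightarrow>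
            \<delta> < \<gamma> / (real r + 1) \<longrightarrow>
            unique_min_cost_matching r d id)"
proof (intro conjI allI impI)
  let ?c = "\<lambda>k l. compat_cost q1 q2 \<Omega> (node q1 (\<alpha> k)) (node q2 (\<alpha> l))"
  note zero = assms(7) and gap = assms(8)
  show "unique_min_cost_matching r ?c id"
  proof (rule unique_min_cost_matching_id_if_diagonal_dominates)
    fix k l assume "k \<in> {1..r}" "l \<in> {1..r}" "k \<noteq> l"
    then show "?c k k < ?c k l"
      using zero[of k] gap[of k l] \<open>\<gamma> > 0\<close> by linarith
  qed
  fix d :: "nat \<Rightarrow> nat \<Rightarrow> real" and \<delta> :: real
  assume close: "\<forall>k\<in>{1..r}. \<forall>l\<in>{1..r}. \<bar>d k l - ?c k l\<bar> \<le> \<delta>"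
    and small: "\<delta> < \<gamma> / (real r + 1)"
  have "\<gamma> / (real r + 1) \<le> \<gamma> / 2"
    using \<open>r \<ge> 1\<close> \<open>\<gamma> > 0\<close> by (intro divide_left_mono) auto
  with small have half: "2 * \<delta> < \<gamma>"
    by linarith
  show "unique_min_cost_matching r d id"
  proof (rule unique_min_cost_matching_id_if_diagonal_dominates)
    fix k l assume kl: "k \<in> {1..r}" "l \<in> {1..r}" "k \<noteq> l"
    have "\<bar>d k k - ?c k k\<bar> \<le> \<delta>" "\<bar>d k l - ?c k l\<bar> \<le> \<delta>"
      using close kl by blast+
    then show "d k k < d k l"
      using zero[OF kl(1)] gap[OF kl] half by linarith
  qed
qed

end
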